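(* Let $\mathcal{A}_{pd}$ be the algorithm for the auto-bidding problem described in the context that bids $b_t=v_t+\frac{v_t}{\lambda_t}$ in slot $t$, where $\lambda_1=1$, $\lambda_t=\exp\left(\alpha\,\mathrm{CCV}(t-1)\right)$ and $\alpha=1/\sqrt{T}$. Then $\mathcal{R}_{\mathcal{A}_{pd}}(T)=\Omega(\sqrt{T})$, even if the distributions $\mathcal{D}$ are restricted to those under which $v_t=v$ for all $t$ and Myerson's condition $p_t(b)=b\,x_t(b)-\int_0^b x_t(u)\,du$ holds.
   Context: Auto-bidding problem over a horizon of $T$ slots. In each slot $t=1,\dots,T$ a triple $(v_t,x_t,p_t)$ is drawn i.i.d. from a distribution $\mathcal{D}$ unknown to the algorithm. Here $v_t\in[0,1]$ is the value; $x_t:[0,\infty)\to[0,1]$ is the allocation function, non-decreasing in the bid with $x_t(0)=0$; $p_t(b)=q_t(b)x_t(b)$ is the expected payment function, where $q_t:[0,\infty)\to[0,1]$ is non-decreasing, is zero when the allocation is zero, and is at most the bid. An online algorithm chooses, in slot $t$, a bid $b_t\ge 0$ knowing only $v_t$ and the past $(v_\tau,x_\tau(b_\tau),p_\tau(b_\tau))_{\tau<t}$; after bidding, $x_t(b_t)$ and $p_t(b_t)$ are revealed. Write $V(T)=\mathbb{E}\{\sum_{t=1}^T v_t x_t(b_t)\}$. The return-on-spend constraint (ROSC) is $\mathbb{E}\{\sum_{t=1}^T p_t(b_t)\}\le\mathbb{E}\{\sum_{t=1}^T v_t x_t(b_t)\}$. $\mathrm{CCV}(\tau)=\sum_{t=1}^{\tau}\left(p_t(b_t)-v_t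 x_t(b_t)\right)$ denotes the cumulative constraint violation up to slot $\tau$ along the algorithm's sample path. The benchmark $\mathsf{OPT}$ maximizes $V(T)$ subject to the ROSC, knowing the distribution $\mathcal{D}$ (but not the realizations in advance). The regret is $\mathcal{R}_{\mathcal{A}}(T)=\max_{\mathcal{D}}\left(V_{\mathsf{OPT}}(T)-V_{\mathcal{A}}(T)\right)$. (The algorithm $\mathcal{A}_{pd}$ itself is not required to satisfy the ROSC.) *)

theory Defs
  imports "HOL-Probability.Probability"
begin

text \<open>
  One slot: the value, the allocation function and the payment function. Bids are non-negative
  reals; the behaviour of the two functions at negative arguments is irrelevant and unconstrained.
\<close>

datatype slot = Slot (val: real) (alloc: "real \<Rightarrow> real") (pay: "real \<Rightarrow> real")

definition valid_slot :: "slot \<Rightarrow> bool" where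
  "valid_slot s \<longleftrightarrow>
     val s \<in> {0..1} \<and>
     mono_on {0..} (alloc s) \<and> alloc s \<in> {0..} \<rightarrow> {0..1} \<and> alloc s 0 = 0 \<and>
     (\<exists>q. mono_on {0..} q \<and> q \<in> {0..} \<rightarrow> {0..1} \<and>
          (\<forall>b\<ge>0. (alloc s b = 0 \<longrightarrow> q b = 0) \<and> q b \<le> b \<and> pay s b = q b * alloc s b))"

text \<open>
  A distribution may come with any \<open>\<sigma>\<close>-algebra that makes the value a random variable and the
  evaluations jointly measurable in slot and bid, so that the allocation and payment
  at a random bid are random variables.
\<close>

definition slot_distribution :: "slot measure \<Rightarrow> bool" where
  "slot_distribution D \<longleftrightarrow>
     prob_space D \<and> (\<forall>s\<in>space D. valid_slot s) \<and>
     val \<in> borel_measurable D \<and>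
     (\<lambda>(s, b). alloc s b) \<in> borel_measurable (D \<Otimes>\<^sub>M restrict_space borel {0..}) \<and>
     (\<lambda>(s, b). pay s b) \<in> borel_measurable (D \<Otimes>\<^sub>M restrict_space borel {0..})"

definition constant_value :: "slot measure \<Rightarrow> bool" where
  "constant_value D \<longleftrightarrow> (\<exists>v. \<forall>s\<in>space D. val s = v)"

definition myerson :: "slot measure \<Rightarrow> bool" where
  "myerson D \<longleftrightarrow>
     (\<forall>s\<in>space D. \<forall>b\<ge>0. pay s b = b * alloc s b - integral {0..b} (alloc s))"

text \<open>
  Slots are numbered from 1. A history maps each past slot to the observed triple of value,
  allocation and payment. An algorithm maps the slot number, the history of the earlier slots and
  the current value to a bid.
\<close>

type_synonym history = "nat \<Rightarrow> real \<times> real \<times> real"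

type_synonym algorithm = "nat \<Rightarrow> history \<Rightarrow> real \<Rightarrow> real"

definition online_algorithm :: "nat \<Rightarrow> algorithm \<Rightarrow> bool" where
  "online_algorithm T A \<longleftrightarrow>
     (\<forall>t\<in>{1..T}. (\<forall>h. \<forall>v\<in>{0..1}. 0 \<le> A t h v) \<and>
        (\<lambda>(h, v). A t h v) \<in> borel_measurable ((\<Pi>\<^sub>M \<tau>\<in>{1..<t}. borel) \<Otimes>\<^sub>M borel))"

primrec hist :: "algorithm \<Rightarrow> (nat \<Rightarrow> slot) \<Rightarrow> nat \<Rightarrow> history" where
  "hist A \<omega> 0 = (\<lambda>_. undefined)"
| "hist A \<omega> (Suc t) =
     (let s = \<omega> (Suc t); b = A (Suc t) (hist A \<omega> t) (val s)
      in (hist A \<omega> t)(Suc t := (val s, alloc s b, pay s b)))"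

definition bid :: "algorithm \<Rightarrow> (nat \<Rightarrow> slot) \<Rightarrow> nat \<Rightarrow> real" where
  "bid A \<omega> t = A t (hist A \<omega> (t - 1)) (val (\<omega> t))"

definition exp_value :: "slot measure \<Rightarrow> nat \<Rightarrow> algorithm \<Rightarrow> real" where
  "exp_value D T A =
     (LINT \<omega>|(\<Pi>\<^sub>M t\<in>{1..T}. D). (\<Sum>t=1..T. val (\<omega> t) * alloc (\<omega> t) (bid A \<omega> t)))"

definition exp_payment :: "slot measure \<Rightarrow> nat \<Rightarrow> algorithm \<Rightarrow> real" where
  "exp_payment D T A =
     (LINT \<omega>|(\<Pi>\<^sub>M t\<in>{1..T}. D). (\<Sum>t=1..T. pay (\<omega> t) (bid A \<omega> t)))"

definition rosc :: "slot measure \<Rightarrow> nat \<Rightarrow> algorithm \<Rightarrow> bool" where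
  "rosc D T A \<longleftrightarrow> exp_payment D T A \<le> exp_value D T A"

text \<open>
  The benchmark may depend on \<open>D\<close>, since the supremum is taken separately for each \<open>D\<close>.
\<close>

definition opt_value :: "slot measure \<Rightarrow> nat \<Rightarrow> ereal" where
  "opt_value D T = (SUP A\<in>{A. online_algorithm T A \<and> rosc D T A}. ereal (exp_value D T A))"

definition regret :: "slot measure set \<Rightarrow> (nat \<Rightarrow> algorithm) \<Rightarrow> nat \<Rightarrow> ereal" where
  "regret \<D> \<A> T = (SUP D\<in>\<D>. opt_value D T - ereal (exp_value D T (\<A> T)))"

definition ccv :: "history \<Rightarrow> nat \<Rightarrow> real" where
  "ccv h \<tau> = (\<Sum>t=1..\<tau>. case h t of (v, x, p) \<Rightarrow> p - v * x)"

definition dual :: "nat \<Rightarrow> history \<Rightarrow> nat \<Rightarrow> real" where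
  "dual T h t = (if t = 1 then 1 else exp (1 / sqrt (real T) * ccv h (t - 1)))"

definition A_pd :: "nat \<Rightarrow> algorithm" where
  "A_pd T t h v = v + v / dual T h t"

lemma online_algorithm_A_pd: "online_algorithm T (A_pd T)"
proof -
  have "(\<lambda>(h, v). A_pd T t h v) \<in> borel_measurable ((\<Pi>\<^sub>M \<tau>\<in>{1..<t}. borel) \<Otimes>\<^sub>M borel)" for t
  proof -
    have "(\<lambda>(h::history, v::real). ccv h (t-1)) \<in> borel_measurable ((\<Pi>\<^sub>M \<tau>\<in>{1..<t}. borel) \<Otimes>\<^sub>M borel)"
      unfolding ccv_def split_beta
    proof (rule borel_measurable_sum)
      fix i assume i: "i \<in> {1..t-1}"
      then have "i \<in> {1..<t}" by auto
      then have [measurable]: "(\<lambda>x::history \<times> real. fst x i) \<in> ((\<Pi>\<^sub>M \<tau>\<in>{1..<t}. borel) \<Otimes>\<^sub>M borel) \<rightarrow>\<^sub>M (borel \<Otimes>\<^sub>M borel \<Otimes>\<^sub>M borel)"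
        unfolding borel_prod
        by (intro measurable_compose[OF measurable_fst measurable_component_singleton])
      show "(\<lambda>x::history \<times> real. snd (snd (fst x i)) - fst (fst x i) * fst (snd (fst x i))) \<in> borel_measurable ((\<Pi>\<^sub>M \<tau>\<in>{1..<t}. borel) \<Otimes>\<^sub>M borel)"
        by measurable
    qed
    then show ?thesis
      unfolding A_pd_def dual_def split_beta by measurable
  qed
  moreover have "0 \<le> A_pd T t h v" if "v \<in> {0..1}" for t h v
    using that by (auto simp: A_pd_def dual_def)
  ultimately show ?thesis
    unfolding online_algorithm_def by blast
qed

text \<open>
  By composition with the next fact, the bids of an online algorithm and the integrands of the two expectations are measurable.
\<close>

lemma measurable_hist:
  assumes D: "slot_distribution D" and A: "online_algorithm T A"
  shows "t \<le> T \<Longrightarrow> (\<lambda>\<omega>. hist A \<omega> t) \<in> (\<Pi>\<^sub>M t\<in>{1..T}. D) \<rightarrow>\<^sub>M (\<Pi>\<^sub>M \<tau>\<in>{1..<Suc t}. borel)"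
proof (induction t)
  case 0
  show ?case by (auto intro!: measurable_PiM_single' simp: PiE_def extensional_def)
next
  case (Suc t)
  let ?M = "\<Pi>\<^sub>M t\<in>{1..T}. D"
  have H: "(\<lambda>\<omega>. hist A \<omega> t) \<in> ?M \<rightarrow>\<^sub>M (\<Pi>\<^sub>M \<tau>\<in>{1..<Suc t}. borel)" using Suc by simp
  have S: "Suc t \<in> {1..T}" using Suc by auto
  have c: "(\<lambda>\<omega>. \<omega> (Suc t)) \<in> ?M \<rightarrow>\<^sub>M D" using S by (rule measurable_component_singleton)
  have v: "(\<lambda>\<omega>. val (\<omega> (Suc t))) \<in> borel_measurable ?M"
    using D unfolding slot_distribution_def by (intro measurable_compose[OF c]) auto
  define b where "b \<omega> = A (Suc t) (hist A \<omega> t) (val (\<omega> (Suc t)))" for \<omega>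
  have b: "b \<in> borel_measurable ?M"
  proof -
    have "(\<lambda>(h, v). A (Suc t) h v) \<in> borel_measurable ((\<Pi>\<^sub>M \<tau>\<in>{1..<Suc t}. borel) \<Otimes>\<^sub>M borel)"
      using A S unfolding online_algorithm_def by blast
    from measurable_compose[OF measurable_Pair[OF H v] this] show ?thesis by (simp add: b_def[abs_def])
  qed
  have b0: "b \<omega> \<ge> 0" if "\<omega> \<in> space ?M" for \<omega>
  proof -
    have "\<omega> (Suc t) \<in> space D" using that S by (auto simp: space_PiM PiE_def Pi_def)
    then have "val (\<omega> (Suc t)) \<in> {0..1}" using D unfolding slot_distribution_def valid_slot_def by blast
    then show ?thesis using A S unfolding online_algorithm_def b_def by blast
  qed
  have b': "b \<in> ?M \<rightarrow>\<^sub>M restrict_space borel {0..}"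
    using b b0 by (intro measurable_restrict_space2) auto
  have x: "(\<lambda>\<omega>. alloc (\<omega> (Suc t)) (b \<omega>)) \<in> borel_measurable ?M"
    using measurable_compose[OF measurable_Pair[OF c b'], of "\<lambda>(s,b). alloc s b" borel] D
    unfolding slot_distribution_def by simp
  have p: "(\<lambda>\<omega>. pay (\<omega> (Suc t)) (b \<omega>)) \<in> borel_measurable ?M"
    using measurable_compose[OF measurable_Pair[OF c b'], of "\<lambda>(s,b). pay s b" borel] D
    unfolding slot_distribution_def by simp
  have e: "{1..<Suc (Suc t)} = insert (Suc t) {1..<Suc t}" by auto
  have "(\<lambda>\<omega>. (hist A \<omega> t)(Suc t := (val (\<omega> (Suc t)), alloc (\<omega> (Suc t)) (b \<omega>), pay (\<omega> (Suc t)) (b \<omega>)))) \<in> ?M \<rightarrow>\<^sub>M (\<Pi>\<^sub>M \<tau>\<in>{1..<Suc (Suc t)}. borel)"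
    unfolding e using H v x p by (intro measurable_fun_upd) (auto simp flip: borel_prod)
  then show ?case unfolding b_def hist.simps Let_def .
qed

end

theory Submission
  imports Defs
begin

text \<open>
  A deterministic slot suffices. Every bid of \<open>A_pd\<close> is positive; one below \<open>3/4\<close> buys value \<open>1/8\<close>
  for free and lowers the violation by \<open>1/8\<close>, one above buys value \<open>1/4\<close> and raises the violation by
  \<open>1/8\<close>. Alternating the two kinds meets the constraint with equality. The algorithm bids \<open>3/4\<close> or
  more only when \<open>\<lambda> \<le> 1/2\<close>, that is when \<open>CCV \<le> - sqrt T * ln 2\<close>, so it ends with an unspent slack
  of order \<open>sqrt T\<close>. Both kinds of bid gain value \<open>3/16\<close> plus half of their violation, so the slack is
  lost value.
\<close>

definition step_slot :: slot where
  "step_slot = Slot (1/4) (\<lambda>b. if b \<le> 0 then 0 else if b < 3/4 then 1/2 else 1)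
     (\<lambda>b. if b < 3/4 then 0 else 3/8)"

text \<open>The underlying set is \<open>{s}\<close>, not the type of all slots: conditions
  quantified over \<open>space D\<close> then concern \<open>s\<close> alone, and a product of
  copies has \<open>s\<close> in every coordinate.\<close>

definition point_distribution :: "slot \<Rightarrow> slot measure" where
  "point_distribution s = return (count_space {s}) s"

lemma space_point_distribution [simp]: "space (point_distribution s) = {s}"
  and sets_point_distribution [simp]: "sets (point_distribution s) = Pow {s}"
  by (simp_all add: point_distribution_def)

lemma prob_space_point_distribution: "prob_space (point_distribution s)"
  unfolding point_distribution_def by (rule prob_space_return) simp

lemma valid_step_slot: "valid_slot step_slot"
  unfolding valid_slot_def step_slot_def
  \<comment> \<open>The unit price \<open>q\<close> can be the payment itself, because the
    allocation is 1 wherever the payment is nonzero.\<close>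
  by (auto simp: mono_on_def intro!: exI[of _ "\<lambda>b::real. if b < 3/4 then 0 else 3/8"])

lemma slot_distribution_point:
  assumes "valid_slot s" "alloc s \<in> borel_measurable borel" "pay s \<in> borel_measurable borel"
  shows "slot_distribution (point_distribution s)"
proof -
  \<comment> \<open>The slot component takes only the value \<open>s\<close>, so joint measurability
    reduces to measurability in the bid.\<close>
  have joint: "(\<lambda>(s', b). f s' b) \<in> borel_measurable (point_distribution s \<Otimes>\<^sub>M restrict_space borel {0..})"
    if "f s \<in> borel_measurable borel" for f :: "slot \<Rightarrow> real \<Rightarrow> real"
  proof -
    have "(\<lambda>x. f s (snd x)) \<in> borel_measurable (point_distribution s \<Otimes>\<^sub>M restrict_space borel {0..})"
      using measurable_restrict_space1[OF that, of "{0..}"]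
      by (rule measurable_compose[OF measurable_snd])
    then show ?thesis
      by (rule measurable_cong[THEN iffD1, rotated]) (auto simp: space_pair_measure)
  qed
  have "val \<in> borel_measurable (point_distribution s)"
    by (auto simp: measurable_def)
  then show ?thesis
    unfolding slot_distribution_def using assms(1)
    by (intro conjI prob_space_point_distribution joint assms) simp_all
qed

lemma slot_distribution_step: "slot_distribution (point_distribution step_slot)"
  by (rule slot_distribution_point[OF valid_step_slot]) (simp_all add: step_slot_def)

lemma constant_value_point: "constant_value (point_distribution s)"
  by (simp add: constant_value_def)

lemma integral_alloc_step_slot:
  assumes "0 \<le> b"
  shows "integral {0..b} (alloc step_slot) = (if b < 3/4 then b/2 else b - 3/8)"
proof -
  \<comment> \<open>At the spike points 0 and 3/4 the allocation is 0 and 1 instead of 1/2.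
    Including \<open>c = 3/4\<close> supplies the left piece of the integral for bids above the
    jump.\<close>
  have low: "(alloc step_slot has_integral c/2) {0..c}" if "0 \<le> c" "c \<le> 3/4" for c
    by (rule has_integral_spike_finite[where S="{0, 3/4}" and f="\<lambda>_. 1/2"])
       (use that has_integral_const_real[of "1/2::real" 0 c] in \<open>auto simp: step_slot_def\<close>)
  show ?thesis
  proof (cases "b < 3/4")
    case True
    then show ?thesis using low[of b] assms by (simp add: integral_unique)
  next
    case False
    have "(alloc step_slot has_integral (b - 3/4)) {3/4..b}"
      by (rule has_integral_eq[where f="\<lambda>_. 1"])
         (use False has_integral_const_real[of "1::real" "3/4" b] in \<open>auto simp: step_slot_def\<close>)
    from has_integral_combine[OF _ _ low[of "3/4"] this] False
    have "(alloc step_slot has_integral (b - 3/8)) {0..b}"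
      by simp
    then show ?thesis using False by (simp add: integral_unique)
  qed
qed

text \<open>Myerson's payment charges each jump of the allocation its size times its location:
  nothing for the jump at 0, and 1/2 * 3/4 = 3/8 for the jump at 3/4.\<close>

lemma myerson_step: "myerson (point_distribution step_slot)"
  unfolding myerson_def
proof (simp, intro allI impI)
  fix b :: real assume "0 \<le> b"
  then show "pay step_slot b = b * alloc step_slot b - integral {0..b} (alloc step_slot)"
    by (subst integral_alloc_step_slot) (auto simp: step_slot_def)
qed

lemma integral_PiM_point_distribution:
  fixes f :: "(nat \<Rightarrow> slot) \<Rightarrow> real"
  assumes "\<And>\<omega>. (\<And>t. t \<in> I \<Longrightarrow> \<omega> t = s) \<Longrightarrow> f \<omega> = c"
  shows "(LINT \<omega>|(\<Pi>\<^sub>M t\<in>I. point_distribution s). f \<omega>) = c"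
proof -
  let ?M = "\<Pi>\<^sub>M t\<in>I. point_distribution s"
  interpret M: prob_space ?M
    by (intro prob_space_PiM prob_space_point_distribution)
  have "(LINT \<omega>|?M. f \<omega>) = (LINT \<omega>|?M. c)"
    by (intro Bochner_Integration.integral_cong refl assms) (auto simp: space_PiM PiE_def Pi_def)
  then show ?thesis by (simp add: M.prob_space)
qed

lemma bid_eq_hist: "bid A \<omega> (Suc t) = A (Suc t) (hist A \<omega> t) (val (\<omega> (Suc t)))"
  by (simp add: bid_def)

lemma ccv_hist_Suc:
  "ccv (hist A \<omega> (Suc t)) (Suc t) = ccv (hist A \<omega> t) t +
     (pay (\<omega> (Suc t)) (bid A \<omega> (Suc t)) - val (\<omega> (Suc t)) * alloc (\<omega> (Suc t)) (bid A \<omega> (Suc t)))"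
  by (simp add: ccv_def bid_eq_hist Let_def)

text \<open>Points of the product space over \<open>{1..T}\<close> agree with a constant sequence
  only on those slots; a history reads no others, so the constant sequence can replace them.\<close>

lemma hist_cong:
  "(\<And>t. t \<in> {1..n} \<Longrightarrow> \<omega> t = \<omega>' t) \<Longrightarrow> hist A \<omega> n = hist A \<omega>' n"
  by (induction n) (simp_all add: Let_def)

lemma bid_cong:
  assumes "\<And>t. t \<in> {1..n} \<Longrightarrow> \<omega> t = \<omega>' t" "n > 0"
  shows "bid A \<omega> n = bid A \<omega>' n"
proof -
  have "hist A \<omega> (n - 1) = hist A \<omega>' (n - 1)"
    using assms by (intro hist_cong) auto
  then show ?thesis using assms by (simp add: bid_def)
qed

lemma
  shows exp_value_point: "exp_value (point_distribution s) T A =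
      (\<Sum>t=1..T. val s * alloc s (bid A (\<lambda>_. s) t))"
    and exp_payment_point: "exp_payment (point_distribution s) T A =
      (\<Sum>t=1..T. pay s (bid A (\<lambda>_. s) t))"
proof -
  have "bid A \<omega> t = bid A (\<lambda>_. s) t" if "\<And>t. t \<in> {1..T} \<Longrightarrow> \<omega> t = s" "t \<in> {1..T}" for \<omega> t
    using that by (intro bid_cong) auto
  note bid = this
  show "exp_value (point_distribution s) T A = (\<Sum>t=1..T. val s * alloc s (bid A (\<lambda>_. s) t))"
    unfolding exp_value_def
  proof (intro integral_PiM_point_distribution sum.cong refl)
    fix \<omega> t assume "\<And>t. t \<in> {1..T} \<Longrightarrow> \<omega> t = s" "t \<in> {1..T}"
    then show "val (\<omega> t) * alloc (\<omega> t) (bid A \<omega> t) = val s * alloc s (bid A (\<lambda>_. s) t)"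
      by (metis bid)
  qed
  show "exp_payment (point_distribution s) T A = (\<Sum>t=1..T. pay s (bid A (\<lambda>_. s) t))"
    unfolding exp_payment_def
  proof (intro integral_PiM_point_distribution sum.cong refl)
    fix \<omega> t assume "\<And>t. t \<in> {1..T} \<Longrightarrow> \<omega> t = s" "t \<in> {1..T}"
    then show "pay (\<omega> t) (bid A \<omega> t) = pay s (bid A (\<lambda>_. s) t)"
      by (metis bid)
  qed
qed

text \<open>At \<open>t = 0\<close> the violation is an empty sum, so the exponential also yields
  the initial multiplier 1.\<close>

lemma dual_Suc: "dual T h (Suc t) = exp (ccv h t / sqrt (real T))"
  by (simp add: dual_def ccv_def)

text \<open>At value 1/4 the bid is 1/4 + 1/(4 \<lambda>), which reaches 3/4 exactly when \<lambda>
  \<le> 1/2.\<close>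

lemma A_pd_high_bid_iff:
  assumes "T > 0"
  shows "3/4 \<le> A_pd T (Suc t) h (1/4) \<longleftrightarrow> ccv h t \<le> - (sqrt (real T) * ln 2)"
proof -
  have "3/4 \<le> A_pd T (Suc t) h (1/4) \<longleftrightarrow> exp (ccv h t / sqrt (real T)) \<le> 1/2"
    by (auto simp: A_pd_def dual_Suc field_simps)
  also have "\<dots> \<longleftrightarrow> ccv h t / sqrt (real T) \<le> ln (1/2)"
    by (rule ln_ge_iff[symmetric]) simp
  also have "\<dots> \<longleftrightarrow> ccv h t \<le> - (sqrt (real T) * ln 2)"
    using assms by (simp add: ln_div field_simps)
  finally show ?thesis .
qed

text \<open>A high bid is made only at or below the threshold \<open>- sqrt (real T) * ln 2\<close>,
  so it ends at most 1/8 above it, and low bids only decrease the violation. The term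
  \<open>- real n / 8\<close> covers runs without any high bid.\<close>

lemma
  assumes "T > 0"
  defines "A \<equiv> A_pd T" and "\<omega> \<equiv> \<lambda>_. step_slot"
  shows A_pd_step_ccv:
      "ccv (hist A \<omega> n) n \<le> max (- real n / 8) (1/8 - sqrt (real T) * ln 2)" (is "?ccv n")
    and A_pd_step_value:
      "(\<Sum>t=1..n. val step_slot * alloc step_slot (bid A \<omega> t)) =
         3 * real n / 16 + ccv (hist A \<omega> n) n / 2" (is "?value n")
proof -
  have "?ccv n \<and> ?value n"
  proof (induction n)
    case 0
    show ?case by (simp add: ccv_def)
  next
    case (Suc n)
    let ?b = "bid A \<omega> (Suc n)"
    have b: "?b = A_pd T (Suc n) (hist A \<omega> n) (1/4)"
      by (simp add: bid_eq_hist A_def \<omega>_def step_slot_def)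
    have pos: "?b > 0"
      by (simp add: b A_pd_def dual_Suc add_pos_pos)
    have high: "3/4 \<le> ?b \<longleftrightarrow> ccv (hist A \<omega> n) n \<le> - (sqrt (real T) * ln 2)"
      using A_pd_high_bid_iff[OF assms(1)] b by simp
    have ccv: "ccv (hist A \<omega> (Suc n)) (Suc n) = ccv (hist A \<omega> n) n + (if 3/4 \<le> ?b then 1/8 else - 1/8)"
      using pos by (simp add: ccv_hist_Suc del: hist.simps) (simp add: \<omega>_def step_slot_def)
    have v: "val step_slot * alloc step_slot ?b = (if 3/4 \<le> ?b then 1/4 else 1/8)"
      using pos by (simp add: step_slot_def)
    have "?value (Suc n)"
      using Suc ccv v
      by (simp del: hist.simps add: add_divide_distrib diff_divide_distrib split: if_splits)
    moreover have "?ccv (Suc n)"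
    proof (cases "3/4 \<le> ?b")
      case True
      then have "ccv (hist A \<omega> (Suc n)) (Suc n) \<le> 1/8 - sqrt (real T) * ln 2"
        unfolding ccv using high by auto
      then show ?thesis by linarith
    next
      case False
      then have "ccv (hist A \<omega> (Suc n)) (Suc n) = ccv (hist A \<omega> n) n - 1/8"
        unfolding ccv by simp
      then show ?thesis using Suc[THEN conjunct1] by (auto simp: max_def split: if_splits)
    qed
    ultimately show ?case by blast
  qed
  then show "?ccv n" "?value n" by auto
qed

text \<open>The constraint concerns only the total, so the high bids may come first instead of
  alternating with the low ones. Rounding down in \<open>T div 2\<close> keeps it satisfied for odd
  \<open>T\<close>.\<close>

definition half_schedule :: "nat \<Rightarrow> algorithm" where
  "half_schedule T t h v = (if t \<le> T div 2 then 3/4 else 1/4)"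

lemma online_algorithm_half_schedule: "online_algorithm T (half_schedule T)"
  unfolding online_algorithm_def half_schedule_def by simp

lemma sum_half:
  "(\<Sum>t=1..T. if t \<le> T div 2 then a else b) = real (T div 2) * a + real (T - T div 2) * b"
proof -
  have "{1..T} \<inter> {t. t \<le> T div 2} = {1..T div 2}" "{1..T} \<inter> - {t. t \<le> T div 2} = {T div 2<..T}"
    by auto
  then show ?thesis by (simp add: sum.If_cases)
qed

lemma exp_value_half_schedule:
  "exp_value (point_distribution step_slot) T (half_schedule T) = real T / 8 + real (T div 2) / 8"
proof -
  have "exp_value (point_distribution step_slot) T (half_schedule T) =
      (\<Sum>t=1..T. if t \<le> T div 2 then 1/4 else 1/8)"
    unfolding exp_value_point by (intro sum.cong) (auto simp: bid_def half_schedule_def step_slot_def)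
  then show ?thesis by (simp add: sum_half field_simps del: One_nat_def)
qed

lemma rosc_half_schedule: "rosc (point_distribution step_slot) T (half_schedule T)"
proof -
  have "exp_payment (point_distribution step_slot) T (half_schedule T) =
      (\<Sum>t=1..T. if t \<le> T div 2 then 3/8 else 0)"
    unfolding exp_payment_point by (intro sum.cong) (auto simp: bid_def half_schedule_def step_slot_def)
  also have "\<dots> = real (T div 2) * (3/8)"
    by (simp only: sum_half)
  finally show ?thesis
    unfolding rosc_def exp_value_half_schedule by simp
qed

lemma regret_A_pd_step:
  assumes "T \<ge> 64"
  shows "ereal (1/8 * sqrt (real T)) \<le>
    opt_value (point_distribution step_slot) T - ereal (exp_value (point_distribution step_slot) T (A_pd T))"
proof -
  let ?D = "point_distribution step_slot" and ?r = "sqrt (real T)"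
  have T: "T > 0" using assms by simp
  have r: "?r \<ge> 8" using assms by (intro real_le_rsqrt) simp
  \<comment> \<open>This makes \<open>- real T / 8\<close> at most \<open>- ?r\<close>, so the
    second term of the maximum in \<open>A_pd_step_ccv\<close> is the larger one.\<close>
  have "8 * ?r \<le> ?r * ?r" using r by (intro mult_right_mono) auto
  then have rT: "8 * ?r \<le> real T" by simp
  have "?r * ln 2 \<le> ?r * 1" using r ln_2_less_1 by (intro mult_left_mono) auto
  then have "- real T / 8 \<le> 1/8 - ?r * ln 2" using rT by simp
  then have alg: "exp_value ?D T (A_pd T) \<le> 3 * real T / 16 + (1/8 - ?r * ln 2) / 2"
    using A_pd_step_ccv[OF T, of T] A_pd_step_value[OF T, of T] by (simp add: exp_value_point)
  \<comment> \<open>An odd horizon costs the competitor at most 1/16.\<close>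
  have "real T \<le> 2 * real (T div 2) + 1" by linarith
  then have opt: "exp_value ?D T (half_schedule T) \<ge> 3 * real T / 16 - 1/16"
    by (simp add: exp_value_half_schedule)
  have "?r * (1/2) \<le> ?r * ln 2" using r ln2_ge_two_thirds by (intro mult_left_mono) auto
  \<comment> \<open>The gap is at least \<open>?r * ln 2 / 2 - 1/8\<close>, hence at least
    \<open>?r / 4 - 1/8\<close>; since \<open>?r\<close> is at least 1, this leaves
    \<open>?r / 8\<close>.\<close>
  then have "1/8 * ?r \<le> exp_value ?D T (half_schedule T) - exp_value ?D T (A_pd T)"
    using alg opt r by argo
  then have "ereal (1/8 * ?r) \<le> ereal (exp_value ?D T (half_schedule T)) - ereal (exp_value ?D T (A_pd T))"
    by simp
  also have "\<dots> \<le> opt_value ?D T - ereal (exp_value ?D T (A_pd T))"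
    unfolding opt_value_def
    by (intro ereal_minus_mono SUP_upper order_refl)
       (simp add: online_algorithm_half_schedule rosc_half_schedule)
  finally show ?thesis .
qed

theorem lemma10:
  "(\<exists>c::real. c > 0 \<and> (\<forall>\<^sub>F T in sequentially.
      ereal (c * sqrt (real T)) \<le> regret {D. slot_distribution D} A_pd T)) \<and>
   (\<exists>c::real. c > 0 \<and> (\<forall>\<^sub>F T in sequentially.
      ereal (c * sqrt (real T)) \<le>
        regret {D. slot_distribution D \<and> constant_value D \<and> myerson D} A_pd T))"
proof -
  \<comment> \<open>One distribution, independent of \<open>T\<close>, lies in both classes and
    serves both conjuncts.\<close>
  have "\<forall>\<^sub>F T in sequentially. ereal (1/8 * sqrt (real T)) \<le> regret \<D> A_pd T"
    if "point_distribution step_slot \<in> \<D>" for \<D>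
    using eventually_ge_at_top[of 64]
  proof eventually_elim
    case (elim T)
    show ?case
      unfolding regret_def using that regret_A_pd_step[OF elim] by (rule SUP_upper2)
  qed
  note this[of "{D. slot_distribution D}"]
    this[of "{D. slot_distribution D \<and> constant_value D \<and> myerson D}"]
  then show ?thesis
    using slot_distribution_step constant_value_point myerson_step
    by (intro conjI exI[of _ "1/8"]) auto
qed

end
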